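(* Let $n\ge 2$ and let $\{1,\dots,n\}=C\,\dot\cup\,D$ be a partition with $|C|=m\ge 1$ and $|D|=n-m\ge 1$. Let $E=\mathrm{diag}(\varepsilon_1,\dots,\varepsilon_n)$ with $\varepsilon_i>0$, let $\Gamma\in\mathbb{R}^{n\times n}$ be a coupling matrix, $\xi\in\mathbb{R}$ with $\xi\neq 0$, and let $\widehat K\in\mathbb{C}^{n\times n}$ be Hermitian positive definite. For $\omega\in\mathbb{R}$ let $$S(\omega)=E\xi^{2}+\Gamma+i\omega I,\qquad S_{DD}^{0}=(E\xi^{2}+\Gamma)_{DD},\qquad L_\infty(\omega)=S_{DD}(\omega)\,\bigl(\widehat K/\widehat K_{CC}\bigr)\,S_{DD}(\omega)^{\mathsf H}.$$ Then: (i) if $S_{DD}^{0}$ is real symmetric and $\widehat K/\widehat K_{CC}=\kappa I$ for a scalar $\kappa$, then $$L_\infty(\omega)=\kappa\bigl((S_{DD}^{0})^{2}+\omega^{2}I\bigr),\qquad \lambda_{\min}\bigl(L_\infty(\omega)\bigr)=\kappa\bigl(\mu_{\min}^{2}+\omega^{2}\bigr),$$ where $\mu_{\min}$ is the eigenvalue of $S_{DD}^{0}$ of smallest modulus; (ii) in the general case, $$\lambda_{\min}(L_\infty(\omega))\ge\sigma_{\min}(S_{DD}^{0}+i\omega I)^{2}\,\lambda_{\min}\bigl(\widehat K/\widehat K_{CC}\bigr),$$ and the right-hand side grows like $\omega^{2}\,\lambda_{\min}(\widehat K/\widehat K_{CC})$ as $|\omega|\to\infty$ (i.e. the ratio of the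 two tends to $1$).
   Context: $M^{\mathsf H}$ denotes the conjugate transpose; $\lambda_{\min}$ the smallest eigenvalue of a Hermitian matrix; $\sigma_{\min}$ the smallest singular value. For $M\in\mathbb{C}^{n\times n}$ and the partition $\{1,\dots,n\}=C\,\dot\cup\,D$, the blocks of $M$ are denoted $M_{CC}$, $M_{CD}$, $M_{DC}$, $M_{DD}$. When $M_{CC}$ is invertible, the Schur complement is $M/M_{CC}:=M_{DD}-M_{DC}M_{CC}^{-1}M_{CD}$. The matrix $\widehat K$ is fixed, independent of $\omega$. (In the underlying setting, $L_\infty(\omega)$ is the limit as $b\to\infty$ of $\widehat G/\widehat G_{CC}$, with $\widehat G=\widehat A\widehat K\widehat A^{\mathsf H}$, $\widehat A=S(\omega)+ib\xi P$, $P=\mathrm{diag}(\mathbf 1_{i\in C})$.) *)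

theory Defs
  imports
    Complex_Main
    "Jordan_Normal_Form.DL_Submatrix"
    "Jordan_Normal_Form.Gauss_Jordan_Elimination"
    "Jordan_Normal_Form.Schur_Decomposition"
    "Jordan_Normal_Form.Spectral_Radius"
begin

text \<open>
  Rows and columns are indexed by 0, ..., n - 1, so a partition of the index set is a partition
  of \<^term>\<open>{..<n}\<close>.  The block of M with rows in I and columns in J is
  \<^term>\<open>submatrix M I J\<close> (indices in increasing order), and the conjugate transpose
  of M is \<^term>\<open>mat_adjoint M\<close>.
\<close>

definition hermitian_mat :: "complex mat \<Rightarrow> bool" where
  "hermitian_mat M \<longleftrightarrow> square_mat M \<and> mat_adjoint M = M"

text \<open>The scalar product below is the quadratic form: the sum of
  \<open>(M v)\<^sub>i \<cdot> cnj v\<^sub>i\<close> over i.\<close>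

definition hermitian_pos_def :: "complex mat \<Rightarrow> bool" where
  "hermitian_pos_def M \<longleftrightarrow> hermitian_mat M \<and>
     (\<forall>v \<in> carrier_vec (dim_row M). v \<noteq> 0\<^sub>v (dim_row M) \<longrightarrow> Re ((M *\<^sub>v v) \<bullet>c v) > 0)"

text \<open>Intended for Hermitian M of positive dimension, whose eigenvalues are all real.\<close>

definition lambda_min :: "complex mat \<Rightarrow> real" where
  "lambda_min M = Min {x. eigenvalue M (complex_of_real x)}"

text \<open>The singular values of M are the nonnegative square roots of the eigenvalues of the
  Hermitian positive semidefinite matrix \<open>M\<^sup>H M\<close>; intended for square M of positive
  dimension.\<close>

definition singular_values :: "complex mat \<Rightarrow> real set" where
  "singular_values M = {s. 0 \<le> s \<and> eigenvalue (mat_adjoint M * M) (complex_of_real (s\<^sup>2))}"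

definition sigma_min :: "complex mat \<Rightarrow> real" where
  "sigma_min M = Min (singular_values M)"

text \<open>A predicate, since an eigenvalue of smallest modulus need not be unique
  (\<open>\<mu>\<close> and \<open>-\<mu>\<close> may both occur).\<close>

definition smallest_modulus_eigenvalue :: "complex mat \<Rightarrow> complex \<Rightarrow> bool" where
  "smallest_modulus_eigenvalue M \<mu> \<longleftrightarrow>
     eigenvalue M \<mu> \<and> (\<forall>\<nu>. eigenvalue M \<nu> \<longrightarrow> cmod \<mu> \<le> cmod \<nu>)"

text \<open>Meaningful when the block with rows and columns in C is invertible; otherwise
  \<^term>\<open>mat_inverse\<close> returns \<^term>\<open>None\<close>.\<close>

definition schur_complement :: "complex mat \<Rightarrow> nat set \<Rightarrow> nat set \<Rightarrow> complex mat" where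
  "schur_complement M C D =
     submatrix M D D - submatrix M D C * the (mat_inverse (submatrix M C C)) * submatrix M C D"

definition S0_mat :: "nat \<Rightarrow> (nat \<Rightarrow> real) \<Rightarrow> real mat \<Rightarrow> real \<Rightarrow> real mat" where
  "S0_mat n \<epsilon> \<Gamma> \<xi> = \<xi>\<^sup>2 \<cdot>\<^sub>m mat_diag n \<epsilon> + \<Gamma>"

definition S_mat :: "nat \<Rightarrow> (nat \<Rightarrow> real) \<Rightarrow> real mat \<Rightarrow> real \<Rightarrow> real \<Rightarrow> complex mat" where
  "S_mat n \<epsilon> \<Gamma> \<xi> \<omega> =
     map_mat complex_of_real (S0_mat n \<epsilon> \<Gamma> \<xi>) + (\<i> * complex_of_real \<omega>) \<cdot>\<^sub>m 1\<^sub>m n"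

definition L_inf :: "nat \<Rightarrow> (nat \<Rightarrow> real) \<Rightarrow> real mat \<Rightarrow> real \<Rightarrow> complex mat \<Rightarrow>
    nat set \<Rightarrow> nat set \<Rightarrow> real \<Rightarrow> complex mat" where
  "L_inf n \<epsilon> \<Gamma> \<xi> K C D \<omega> =
     submatrix (S_mat n \<epsilon> \<Gamma> \<xi> \<omega>) D D * schur_complement K C D *
     mat_adjoint (submatrix (S_mat n \<epsilon> \<Gamma> \<xi> \<omega>) D D)"

end

theory Submission
  imports Defs
begin

text \<open>
  Two facts about Hermitian matrices carry the theorem.

  A Hermitian matrix \<open>A\<close> satisfies \<open>lambda_min A * |v|\<^sup>2 \<le> \<langle>A v, v\<rangle>\<close>, with equality at some nonzero \<open>v\<close>
  (\<open>lambda_min_quad_form\<close>, \<open>lambda_min_eigenvalue\<close>).  The proof is variational: the greatest lower bound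
  \<open>t\<close> of the Rayleigh quotient is an eigenvalue, since a positive semidefinite and invertible
  \<open>A - t I\<close> would have a form bounded away from 0, against the choice of \<open>t\<close>
  (\<open>hermitian_min_eigenvalue_exists\<close>).  Applied to \<open>M\<^sup>H M\<close> it describes the square of the smallest
  singular value of \<open>M\<close> (\<open>sigma_min_square\<close>).

  The Schur complement of a positive definite matrix \<open>K\<close> has the form \<open>T\<^sup>H K T\<close> for an injective \<open>T\<close>, and
  is therefore positive definite (\<open>schur_complement_pos_def\<close>); in particular its least eigenvalue is
  positive.

  Taking the block on \<open>D\<close> commutes with adding \<open>i \<omega> I\<close>, so the limit matrix is \<open>N Q N\<^sup>H\<close> with
  \<open>N = S + i \<omega> I\<close>, where \<open>S\<close> is the real block and \<open>Q\<close> the Schur complement.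

  For the first part, \<open>S\<close> is Hermitian and \<open>Q = \<kappa> I\<close>, hence \<open>N N\<^sup>H = (S + i \<omega> I) (S - i \<omega> I) = S\<^sup>2 + \<omega>\<^sup>2 I\<close>.
  The eigenvalues of \<open>S\<^sup>2\<close> are the squares of those of \<open>S\<close>, and the least of these belongs to the
  eigenvalues of smallest modulus (\<open>lambda_min_scaled_square_shift\<close>).

  For the second part, \<open>\<langle>N Q N\<^sup>H v, v\<rangle> \<ge> lambda_min Q * |N\<^sup>H v|\<^sup>2\<close>, and \<open>|N\<^sup>H v|\<^sup>2\<close> is at least the squared
  smallest singular value of \<open>N\<close> times \<open>|v|\<^sup>2\<close>, because \<open>N N\<^sup>H\<close> and \<open>N\<^sup>H N\<close> have the same eigenvalues
  (\<open>lambda_min_congruence_ge\<close>).  Finally \<open>|N v|\<^sup>2\<close> differs from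
  \<open>\<omega>\<^sup>2 |v|\<^sup>2\<close> by at most a constant times \<open>(1 + |\<omega>|) |v|\<^sup>2\<close>, so the squared smallest singular value of \<open>N\<close> is asymptotic
  to \<open>\<omega>\<^sup>2\<close> (\<open>sigma_min_imaginary_shift_asymp\<close>).
\<close>

section \<open>The conjugate transpose and quadratic forms\<close>

lemma adjoint_dim [simp]:
  "dim_row (mat_adjoint A) = dim_col A" "dim_col (mat_adjoint A) = dim_row A"
  unfolding mat_adjoint_def by auto

lemma adjoint_carrier [simp]: "A \<in> carrier_mat n k \<Longrightarrow> mat_adjoint A \<in> carrier_mat k n"
  by (auto intro: carrier_matI)

lemma adjoint_index [simp]:
  "i < dim_col A \<Longrightarrow> j < dim_row A \<Longrightarrow> mat_adjoint A $$ (i, j) = conjugate (A $$ (j, i))"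
  unfolding mat_adjoint_def by (auto simp: mat_of_rows_index)

lemma adjoint_adjoint: "mat_adjoint (mat_adjoint A) = A"
  by (rule eq_matI) auto

lemma adjoint_times:
  fixes A B :: "'a :: conjugatable_field mat"
  assumes "A \<in> carrier_mat n k" "B \<in> carrier_mat k l"
  shows "mat_adjoint (A * B) = mat_adjoint B * mat_adjoint A"
  using assms
  by (intro eq_matI)
     (auto simp: scalar_prod_def sum_conjugate conjugate_dist_mul mult.commute intro!: sum.cong)

lemma adjoint_cscalar_prod:
  fixes A :: "'a :: conjugatable_field mat"
  assumes A: "A \<in> carrier_mat n k" and v: "v \<in> carrier_vec k" and w: "w \<in> carrier_vec n"
  shows "(A *\<^sub>v v) \<bullet>c w = v \<bullet>c (mat_adjoint A *\<^sub>v w)"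
proof -
  have "(A *\<^sub>v v) \<bullet>c w = (\<Sum>i<n. \<Sum>j<k. A $$ (i, j) * v $ j * conjugate (w $ i))"
    using assms by (auto simp: scalar_prod_def sum_distrib_right lessThan_atLeast0 intro!: sum.cong)
  also have "\<dots> = (\<Sum>j<k. \<Sum>i<n. A $$ (i, j) * v $ j * conjugate (w $ i))"
    by (rule sum.swap)
  also have "\<dots> = v \<bullet>c (mat_adjoint A *\<^sub>v w)"
    using assms
    by (auto simp: scalar_prod_def sum_distrib_left sum_conjugate conjugate_dist_mul
        lessThan_atLeast0 mult_ac intro!: sum.cong)
  finally show ?thesis .
qed

lemma cscalar_prod_self:
  fixes v :: "complex vec"
  shows "Re (v \<bullet>c v) = (\<Sum>i<dim_vec v. (cmod (v $ i))\<^sup>2)"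
  by (simp add: scalar_prod_def lessThan_atLeast0 cmod_power2 flip: power2_eq_square)

lemma cscalar_prod_self_of_real:
  fixes v :: "complex vec"
  shows "v \<bullet>c v = complex_of_real (Re (v \<bullet>c v))"
  unfolding cscalar_prod_self
  by (simp add: scalar_prod_def lessThan_atLeast0 complex_norm_square del: of_real_power)

lemma cscalar_prod_self_pos:
  fixes v :: "complex vec"
  assumes "v \<in> carrier_vec n" "v \<noteq> 0\<^sub>v n"
  shows "Re (v \<bullet>c v) > 0"
  using conjugate_square_greater_0_vec[OF assms(1)] assms(2) by (simp add: less_complex_def)

lemma cscalar_prod_self_nonneg: "Re (v \<bullet>c (v :: complex vec)) \<ge> 0"
  unfolding cscalar_prod_self by (simp add: sum_nonneg)

text \<open>
  For Hermitian \<open>A\<close> the sum is real already.  The real part also gives a meaning to the form of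
  other matrices, such as \<open>- i M\<close> below.
\<close>

abbreviation quad_form :: "complex mat \<Rightarrow> complex vec \<Rightarrow> real" where
  "quad_form A v \<equiv> Re ((A *\<^sub>v v) \<bullet>c v)"

lemma quad_form_congruence:
  assumes "A \<in> carrier_mat n n" "T \<in> carrier_mat n k" "v \<in> carrier_vec k"
  shows "quad_form (mat_adjoint T * A * T) v = quad_form A (T *\<^sub>v v)"
proof -
  have "mat_adjoint T * A * T *\<^sub>v v = mat_adjoint T *\<^sub>v (A *\<^sub>v (T *\<^sub>v v))"
    using assms assoc_mult_mat_vec[OF mult_carrier_mat[OF adjoint_carrier], of T n k A n T k v]
      assoc_mult_mat_vec[of "mat_adjoint T" k n A n "T *\<^sub>v v"] by simp
  then show ?thesis
    using adjoint_cscalar_prod[of "mat_adjoint T" k n "A *\<^sub>v (T *\<^sub>v v)" v] assms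
    by (simp add: adjoint_adjoint)
qed

text \<open>
  Since every product of two coordinates of \<open>v\<close> is at most \<open>|v|\<^sup>2\<close>, the sum of the moduli of the
  entries serves as the constant; 1 is added to make it positive also for the zero matrix.
\<close>

lemma quad_form_bounded:
  fixes A :: "complex mat"
  assumes A: "A \<in> carrier_mat n n"
  obtains c where "c > 0" "\<And>v. v \<in> carrier_vec n \<Longrightarrow> \<bar>quad_form A v\<bar> \<le> c * Re (v \<bullet>c v)"
proof
  let ?c = "1 + (\<Sum>i<n. \<Sum>j<n. cmod (A $$ (i, j)))"
  show "?c > 0" by (simp add: add_pos_nonneg sum_nonneg)
  fix v :: "complex vec" assume v: "v \<in> carrier_vec n"
  have entry: "cmod (v $ i) * cmod (v $ j) \<le> Re (v \<bullet>c v)" if "i < n" "j < n" for i j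
  proof -
    have "(cmod (v $ k))\<^sup>2 \<le> Re (v \<bullet>c v)" if "k < n" for k
      unfolding cscalar_prod_self using v that
      by (intro member_le_sum) auto
    with that have "(cmod (v $ i))\<^sup>2 \<le> Re (v \<bullet>c v)" "(cmod (v $ j))\<^sup>2 \<le> Re (v \<bullet>c v)" by auto
    moreover have "2 * (cmod (v $ i) * cmod (v $ j)) \<le> (cmod (v $ i))\<^sup>2 + (cmod (v $ j))\<^sup>2"
      using sum_squares_bound[of "cmod (v $ i)" "cmod (v $ j)"] by simp
    ultimately show ?thesis by linarith
  qed
  have "(A *\<^sub>v v) \<bullet>c v = (\<Sum>i<n. \<Sum>j<n. A $$ (i, j) * v $ j * cnj (v $ i))"
    using A v by (auto simp: scalar_prod_def sum_distrib_right lessThan_atLeast0 intro!: sum.cong)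
  then have "cmod ((A *\<^sub>v v) \<bullet>c v) \<le> (\<Sum>i<n. \<Sum>j<n. cmod (A $$ (i, j) * v $ j * cnj (v $ i)))"
    by (simp only:) (intro order_trans[OF norm_sum] sum_mono norm_sum)
  also have "\<dots> \<le> (\<Sum>i<n. \<Sum>j<n. cmod (A $$ (i, j)) * Re (v \<bullet>c v))"
    by (intro sum_mono) (simp add: norm_mult mult.assoc entry mult_left_mono)
  also have "\<dots> \<le> ?c * Re (v \<bullet>c v)"
    by (simp add: sum_distrib_right[symmetric] ring_distribs cscalar_prod_self_nonneg)
  finally show "\<bar>quad_form A v\<bar> \<le> ?c * Re (v \<bullet>c v)"
    using abs_Re_le_cmod order_trans by blast
qed

lemma hermitian_cscalar_prod_cnj:
  assumes "A \<in> carrier_mat n n" "mat_adjoint A = A" "v \<in> carrier_vec n" "w \<in> carrier_vec n"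
  shows "(A *\<^sub>v v) \<bullet>c w = cnj ((A *\<^sub>v w) \<bullet>c v)"
proof -
  have "(A *\<^sub>v v) \<bullet>c w = v \<bullet>c (A *\<^sub>v w)"
    using adjoint_cscalar_prod[of A n n v w] assms by simp
  also have "\<dots> = cnj ((A *\<^sub>v w) \<bullet>c v)"
    using assms
    by (auto simp: scalar_prod_def mult.commute intro!: sum.cong)
  finally show ?thesis .
qed

lemma quad_form_add:
  assumes A: "A \<in> carrier_mat n n" and H: "mat_adjoint A = A"
    and x: "x \<in> carrier_vec n" and y: "y \<in> carrier_vec n"
  shows "quad_form A (x + complex_of_real s \<cdot>\<^sub>v y) =
    quad_form A x + 2 * s * Re ((A *\<^sub>v y) \<bullet>c x) + s\<^sup>2 * quad_form A y"
proof -
  have [simp]: "A *\<^sub>v x \<in> carrier_vec n" "A *\<^sub>v y \<in> carrier_vec n" using A x y by auto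
  have c: "conjugate (x + complex_of_real s \<cdot>\<^sub>v y) = conjugate x + complex_of_real s \<cdot>\<^sub>v conjugate y"
    using x y by (subst conjugate_add_vec[of _ n]) (auto simp: conjugate_smult_vec)
  have "A *\<^sub>v (x + complex_of_real s \<cdot>\<^sub>v y) = A *\<^sub>v x + complex_of_real s \<cdot>\<^sub>v (A *\<^sub>v y)"
    using A x y by (simp add: mult_add_distrib_mat_vec mult_mat_vec)
  then have "(A *\<^sub>v (x + complex_of_real s \<cdot>\<^sub>v y)) \<bullet>c (x + complex_of_real s \<cdot>\<^sub>v y) =
      (A *\<^sub>v x) \<bullet>c x + s * ((A *\<^sub>v y) \<bullet>c x) + s * ((A *\<^sub>v x) \<bullet>c y) + s * s * ((A *\<^sub>v y) \<bullet>c y)"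
    unfolding c using A x y
    by (simp add: add_scalar_prod_distrib[of _ n] scalar_prod_add_distrib[of _ n]
        algebra_simps)
  moreover have "Re ((A *\<^sub>v x) \<bullet>c y) = Re ((A *\<^sub>v y) \<bullet>c x)"
    using hermitian_cscalar_prod_cnj[OF A H x y] by simp
  ultimately show ?thesis by (simp add: power2_eq_square)
qed

lemma mat_mult_zero_vec:
  fixes A :: "'a :: semiring_0 mat"
  shows "A \<in> carrier_mat n k \<Longrightarrow> A *\<^sub>v 0\<^sub>v k = 0\<^sub>v n"
  by (intro eq_vecI) auto

lemma minus_zero_mat:
  fixes A :: "'a :: group_add mat"
  shows "A \<in> carrier_mat n k \<Longrightarrow> A - 0\<^sub>m n k = A"
  by (intro eq_matI) auto

lemma smult_one_mat_mult_vec: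
  fixes v :: "'a :: comm_semiring_1 vec"
  shows "v \<in> carrier_vec n \<Longrightarrow> (c \<cdot>\<^sub>m 1\<^sub>m n) *\<^sub>v v = c \<cdot>\<^sub>v v"
  by (intro eq_vecI) auto

lemma quad_form_shift:
  assumes "A \<in> carrier_mat n n" "v \<in> carrier_vec n"
  shows "quad_form (A - complex_of_real t \<cdot>\<^sub>m 1\<^sub>m n) v = quad_form A v - t * Re (v \<bullet>c v)"
proof -
  have "(A - complex_of_real t \<cdot>\<^sub>m 1\<^sub>m n) *\<^sub>v v = A *\<^sub>v v - complex_of_real t \<cdot>\<^sub>v v"
    using assms minus_mult_distrib_mat_vec[OF assms(1) _ assms(2), of "complex_of_real t \<cdot>\<^sub>m 1\<^sub>m n"]
    by (simp add: smult_one_mat_mult_vec)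
  then show ?thesis
    using assms minus_scalar_prod_distrib[of "A *\<^sub>v v" n "complex_of_real t \<cdot>\<^sub>v v" "conjugate v"]
    by (simp add: mult_mat_vec_carrier)
qed

section \<open>The smallest eigenvalue as a minimum of the quadratic form\<close>

text \<open>
  A positive semidefinite form whose matrix is invertible is bounded away from 0.  With the inverse
  \<open>G\<close> of \<open>A\<close> and \<open>y = G v\<close>, the form along the line \<open>v - s y\<close> is
  \<open>quad_form A v - 2 s |v|\<^sup>2 + s\<^sup>2 \<langle>v, G v\<rangle>\<close>, where the last coefficient is at most \<open>c |v|\<^sup>2\<close>
  for a bound \<open>c\<close> of the form of \<open>G\<close>.  Nonnegativity at \<open>s = 1 / c\<close> gives the claim with
  \<open>d = 1 / c\<close>.
\<close>

lemma quad_form_bound_of_invertible: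
  assumes A: "A \<in> carrier_mat n n" and H: "mat_adjoint A = A"
    and psd: "\<And>v. v \<in> carrier_vec n \<Longrightarrow> quad_form A v \<ge> 0"
    and inv: "det A \<noteq> 0"
  obtains d where "d > 0" "\<And>v. v \<in> carrier_vec n \<Longrightarrow> d * Re (v \<bullet>c v) \<le> quad_form A v"
proof -
  obtain G where G: "G \<in> carrier_mat n n" and AG: "A * G = 1\<^sub>m n"
    using det_non_zero_imp_unit[OF A inv, of "()"] by (auto simp: Units_def ring_mat_def)
  obtain c where c: "c > 0" "\<And>v. v \<in> carrier_vec n \<Longrightarrow> \<bar>quad_form G v\<bar> \<le> c * Re (v \<bullet>c v)"
    using quad_form_bounded[OF G] by blast
  show ?thesis
  proof (rule that[of "1 / c"])
    fix v :: "complex vec" assume v: "v \<in> carrier_vec n"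
    let ?y = "G *\<^sub>v v"
    have y: "?y \<in> carrier_vec n" using G v by simp
    have Ay: "A *\<^sub>v ?y = v" using A G v AG by (metis assoc_mult_mat_vec one_mult_mat_vec)
    have "v \<bullet>c ?y = cnj (?y \<bullet>c v)"
      using v carrier_vecD[OF y] by (auto simp: scalar_prod_def mult.commute intro!: sum.cong)
    then have "quad_form A ?y \<le> c * Re (v \<bullet>c v)" using c(2)[OF v] Ay by simp
    then have b: "(1 / c)\<^sup>2 * quad_form A ?y \<le> 1 / c * Re (v \<bullet>c v)"
      using c(1) by (simp add: power2_eq_square field_simps)
    have "0 \<le> quad_form A (v + complex_of_real (- (1 / c)) \<cdot>\<^sub>v ?y)"
      using v y by (intro psd) auto
    also have "\<dots> = quad_form A v - 2 / c * Re (v \<bullet>c v) + (1 / c)\<^sup>2 * quad_form A ?y"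
      using quad_form_add[OF A H v y, of "- (1 / c)"] unfolding Ay by simp
    finally show "1 / c * Re (v \<bullet>c v) \<le> quad_form A v" using b by simp
  qed (use c in auto)
qed

lemma hermitian_shift:
  assumes "A \<in> carrier_mat n n" "mat_adjoint A = A"
  shows "mat_adjoint (A - complex_of_real t \<cdot>\<^sub>m 1\<^sub>m n) = A - complex_of_real t \<cdot>\<^sub>m 1\<^sub>m n"
proof (rule eq_matI)
  fix i j assume "i < dim_row (A - complex_of_real t \<cdot>\<^sub>m 1\<^sub>m n)" "j < dim_col (A - complex_of_real t \<cdot>\<^sub>m 1\<^sub>m n)"
  then have ij: "i < n" "j < n" by auto
  then have "cnj (A $$ (j, i)) = A $$ (i, j)"
    using assms adjoint_index[of i A j] by simp
  then show "mat_adjoint (A - complex_of_real t \<cdot>\<^sub>m 1\<^sub>m n) $$ (i, j) = (A - complex_of_real t \<cdot>\<^sub>m 1\<^sub>m n) $$ (i, j)"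
    using ij assms by simp
qed (use assms in auto)

text \<open>
  Let \<open>t\<close> be the largest number with \<open>t |v|\<^sup>2 \<le> quad_form A v\<close> for all \<open>v\<close>.  Then \<open>A - t I\<close> is
  positive semidefinite.  Were it invertible, its form would dominate \<open>d |v|\<^sup>2\<close> for some \<open>d > 0\<close>, and
  \<open>t + d\<close> would still be a lower bound; hence \<open>A - t I\<close> is singular, that is, \<open>t\<close> is an
  eigenvalue.
\<close>

lemma hermitian_min_eigenvalue_exists:
  assumes A: "A \<in> carrier_mat n n" and H: "mat_adjoint A = A" and n: "n > 0"
  obtains t where "eigenvalue A (complex_of_real t)"
    "\<And>v. v \<in> carrier_vec n \<Longrightarrow> t * Re (v \<bullet>c v) \<le> quad_form A v"
proof -
  define R where "R = {t. \<forall>v \<in> carrier_vec n. t * Re (v \<bullet>c v) \<le> quad_form A v}"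
  obtain c where c: "\<And>v. v \<in> carrier_vec n \<Longrightarrow> \<bar>quad_form A v\<bar> \<le> c * Re (v \<bullet>c v)"
    using quad_form_bounded[OF A] by blast
  have ne: "- c \<in> R" unfolding R_def using c by (force simp: abs_le_iff)
  let ?e = "unit_vec n 0 :: complex vec"
  have e: "Re (?e \<bullet>c ?e) > 0" by (rule cscalar_prod_self_pos[of _ n]) (use n in auto)
  have bdd: "bdd_above R"
  proof (rule bdd_aboveI)
    fix t assume "t \<in> R"
    then have "t * Re (?e \<bullet>c ?e) \<le> quad_form A ?e" by (simp add: R_def)
    then show "t \<le> quad_form A ?e / Re (?e \<bullet>c ?e)" using e by (simp add: field_simps)
  qed
  define t where "t = Sup R"
  have low: "t * Re (v \<bullet>c v) \<le> quad_form A v" if v: "v \<in> carrier_vec n" for v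
  proof (cases "Re (v \<bullet>c v) = 0")
    case True
    then have "v = 0\<^sub>v n" using cscalar_prod_self_pos[OF v] by fastforce
    then show ?thesis using A by simp
  next
    case False
    then have p: "Re (v \<bullet>c v) > 0" using cscalar_prod_self_nonneg[of v] by simp
    have "t \<le> quad_form A v / Re (v \<bullet>c v)"
      unfolding t_def
    proof (rule cSup_least)
      show "R \<noteq> {}" using ne by blast
    qed (use p v in \<open>auto simp: R_def field_simps\<close>)
    then show ?thesis using p by (simp add: field_simps)
  qed
  let ?B = "A - complex_of_real t \<cdot>\<^sub>m 1\<^sub>m n"
  have B: "?B \<in> carrier_mat n n" using A by auto
  have "det ?B = 0"
  proof (rule ccontr)
    assume "det ?B \<noteq> 0"
    then obtain d where d: "d > 0" "\<And>v. v \<in> carrier_vec n \<Longrightarrow> d * Re (v \<bullet>c v) \<le> quad_form ?B v"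
      using quad_form_bound_of_invertible[OF B hermitian_shift[OF A H]] low quad_form_shift[OF A]
      by (metis diff_ge_0_iff_ge)
    have "t + d \<in> R"
      unfolding R_def using d(2) quad_form_shift[OF A] by (force simp: algebra_simps)
    then have "t + d \<le> t" unfolding t_def using bdd by (intro cSup_upper)
    then show False using d(1) by simp
  qed
  moreover have "?B = char_matrix A (complex_of_real t)"
    using A by (auto simp: char_matrix_def)
  ultimately have "eigenvalue A (complex_of_real t)" using eigenvalue_det[OF A] by simp
  then show ?thesis using low that by blast
qed

lemma eigenvalue_quad_form:
  assumes "A \<in> carrier_mat n n" "eigenvalue A (complex_of_real x)"
  obtains v where "v \<in> carrier_vec n" "Re (v \<bullet>c v) > 0" "quad_form A v = x * Re (v \<bullet>c v)"
proof -
  from assms obtain v where v: "v \<in> carrier_vec n" "v \<noteq> 0\<^sub>v n" "A *\<^sub>v v = complex_of_real x \<cdot>\<^sub>v v"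
    by (auto simp: eigenvalue_def eigenvector_def)
  then show ?thesis using that[OF v(1) cscalar_prod_self_pos[OF v(1,2)]] by simp
qed

lemma finite_real_eigenvalues:
  assumes "A \<in> carrier_mat n n"
  shows "finite {x. eigenvalue A (complex_of_real x)}"
proof -
  have "finite (complex_of_real -` spectrum A)"
    using card_finite_spectrum(1)[OF assms] by (intro finite_vimageI) (auto simp: inj_on_def)
  then show ?thesis by (simp add: spectrum_def vimage_def)
qed

lemma lambda_min_eqI:
  assumes A: "A \<in> carrier_mat n n" and ev: "eigenvalue A (complex_of_real t)"
    and least: "\<And>x. eigenvalue A (complex_of_real x) \<Longrightarrow> t \<le> x"
  shows "lambda_min A = t"
  unfolding lambda_min_def
  using finite_real_eigenvalues[OF A] ev least by (intro Min_eqI) auto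

lemma lambda_min_le:
  assumes "A \<in> carrier_mat n n" "eigenvalue A (complex_of_real x)"
  shows "lambda_min A \<le> x"
  unfolding lambda_min_def using finite_real_eigenvalues[OF assms(1)] assms(2) by (intro Min_le) auto

text \<open>
  The eigenvalue that bounds the quadratic form from below is the least one, because evaluating the
  form at any other eigenvector returns the corresponding eigenvalue.
\<close>

lemma
  assumes A: "A \<in> carrier_mat n n" and H: "mat_adjoint A = A" and n: "n > 0"
  shows lambda_min_eigenvalue: "eigenvalue A (complex_of_real (lambda_min A))"
    and lambda_min_quad_form:
      "v \<in> carrier_vec n \<Longrightarrow> lambda_min A * Re (v \<bullet>c v) \<le> quad_form A v"
proof -
  obtain t where t: "eigenvalue A (complex_of_real t)"
    "\<And>v. v \<in> carrier_vec n \<Longrightarrow> t * Re (v \<bullet>c v) \<le> quad_form A v"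
    using hermitian_min_eigenvalue_exists[OF assms] by blast
  have eq: "lambda_min A = t"
  proof (rule lambda_min_eqI[OF A t(1)])
    fix x assume "eigenvalue A (complex_of_real x)"
    then obtain v where "v \<in> carrier_vec n" "Re (v \<bullet>c v) > 0" "quad_form A v = x * Re (v \<bullet>c v)"
      using eigenvalue_quad_form[OF A] by blast
    then show "t \<le> x" using t(2)[of v] by simp
  qed
  show "eigenvalue A (complex_of_real (lambda_min A))" unfolding eq by (rule t(1))
  show "lambda_min A * Re (v \<bullet>c v) \<le> quad_form A v" if "v \<in> carrier_vec n" for v
    unfolding eq by (rule t(2)[OF that])
qed

lemma lambda_min_geI:
  assumes "A \<in> carrier_mat n n" "mat_adjoint A = A" "n > 0"
    and "\<And>v. v \<in> carrier_vec n \<Longrightarrow> t * Re (v \<bullet>c v) \<le> quad_form A v"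
  shows "t \<le> lambda_min A"
proof -
  obtain v where v: "v \<in> carrier_vec n" "Re (v \<bullet>c v) > 0"
    "quad_form A v = lambda_min A * Re (v \<bullet>c v)"
    using eigenvalue_quad_form[OF assms(1) lambda_min_eigenvalue[OF assms(1-3)]] .
  show ?thesis using assms(4)[OF v(1)] v(2,3) by simp
qed

lemma hermitian_eigenvalue_real:
  assumes A: "A \<in> carrier_mat n n" and H: "mat_adjoint A = A" and ev: "eigenvalue A z"
  shows "z = complex_of_real (Re z)"
proof -
  from ev obtain v where v: "v \<in> carrier_vec n" "v \<noteq> 0\<^sub>v n" "A *\<^sub>v v = z \<cdot>\<^sub>v v"
    using A by (auto simp: eigenvalue_def eigenvector_def)
  have "(A *\<^sub>v v) \<bullet>c v = z * (v \<bullet>c v)" using v by simp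
  moreover have "(A *\<^sub>v v) \<bullet>c v = cnj ((A *\<^sub>v v) \<bullet>c v)"
    using hermitian_cscalar_prod_cnj[OF A H v(1) v(1)] .
  moreover have "cnj (v \<bullet>c v) = v \<bullet>c v"
    using cscalar_prod_self_of_real[of v] by (metis complex_cnj_complex_of_real)
  ultimately have "z * (v \<bullet>c v) = cnj z * (v \<bullet>c v)" by (metis complex_cnj_mult)
  moreover have "v \<bullet>c v \<noteq> 0" using cscalar_prod_self_pos[OF v(1,2)] by force
  ultimately have "cnj z = z" by simp
  then show ?thesis by (simp add: complex_eq_iff)
qed

section \<open>Positive definite matrices\<close>

lemma hermitian_pos_def_iff:
  assumes "A \<in> carrier_mat n n"
  shows "hermitian_pos_def A \<longleftrightarrow> mat_adjoint A = A \<and>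
    (\<forall>v \<in> carrier_vec n. v \<noteq> 0\<^sub>v n \<longrightarrow> quad_form A v > 0)"
  using assms by (auto simp: hermitian_pos_def_def hermitian_mat_def)

lemma hermitian_congruence:
  assumes A: "A \<in> carrier_mat n n" and H: "mat_adjoint A = A" and T: "T \<in> carrier_mat n k"
  shows "mat_adjoint (mat_adjoint T * A * T) = mat_adjoint T * A * T"
proof -
  have T': "mat_adjoint T \<in> carrier_mat k n" using T by simp
  show ?thesis
    using adjoint_times[OF mult_carrier_mat[OF T' A] T] adjoint_times[OF T' A]
      assoc_mult_mat[OF T' A T]
    by (simp add: adjoint_adjoint H)
qed

text \<open>
  A left inverse \<open>L\<close> forces \<open>T\<close> to be injective, so that no nonzero vector is lost on the way
  to the form of \<open>A\<close>.
\<close>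

lemma hermitian_pos_def_congruence:
  assumes A: "A \<in> carrier_mat n n" and pd: "hermitian_pos_def A"
    and T: "T \<in> carrier_mat n k" and L: "L \<in> carrier_mat k n" and LT: "L * T = 1\<^sub>m k"
  shows "hermitian_pos_def (mat_adjoint T * A * T)"
proof -
  have car: "mat_adjoint T * A * T \<in> carrier_mat k k"
    using T A by (intro mult_carrier_mat[OF mult_carrier_mat[OF adjoint_carrier]]) auto
  have "quad_form (mat_adjoint T * A * T) v > 0" if v: "v \<in> carrier_vec k" "v \<noteq> 0\<^sub>v k" for v
  proof -
    have "T *\<^sub>v v \<noteq> 0\<^sub>v n"
    proof
      assume "T *\<^sub>v v = 0\<^sub>v n"
      then have "L * T *\<^sub>v v = 0\<^sub>v k" using assoc_mult_mat_vec[OF L T v(1)] mat_mult_zero_vec[OF L] by simp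
      then show False using LT v by simp
    qed
    moreover have "T *\<^sub>v v \<in> carrier_vec n" using T v by simp
    ultimately show ?thesis
      unfolding quad_form_congruence[OF A T v(1)] using pd hermitian_pos_def_iff[OF A] by blast
  qed
  moreover have "mat_adjoint A = A" using pd hermitian_pos_def_iff[OF A] by blast
  ultimately show ?thesis
    using hermitian_pos_def_iff[OF car] hermitian_congruence[OF A _ T] by blast
qed

lemma hermitian_pos_def_det_nonzero:
  assumes A: "A \<in> carrier_mat n n" and pd: "hermitian_pos_def A"
  shows "det A \<noteq> 0"
proof
  assume "det A = 0"
  then obtain v where v: "v \<in> carrier_vec n" "v \<noteq> 0\<^sub>v n" "A *\<^sub>v v = 0\<^sub>v n"
    using det_0_iff_vec_prod_zero_field[OF A] by auto
  then show False using pd[unfolded hermitian_pos_def_iff[OF A]] by force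
qed

lemma hermitian_pos_def_lambda_min_pos:
  assumes A: "A \<in> carrier_mat n n" and pd: "hermitian_pos_def A" and n: "n > 0"
  shows "lambda_min A > 0"
proof -
  have H: "mat_adjoint A = A" using pd hermitian_pos_def_iff[OF A] by blast
  obtain v where v: "v \<in> carrier_vec n" "Re (v \<bullet>c v) > 0" "quad_form A v = lambda_min A * Re (v \<bullet>c v)"
    using eigenvalue_quad_form[OF A lambda_min_eigenvalue[OF A H n]] .
  then have "v \<noteq> 0\<^sub>v n" by auto
  then have "quad_form A v > 0" using pd hermitian_pos_def_iff[OF A] v(1) by blast
  then show ?thesis using v(2,3) by (simp add: zero_less_mult_iff)
qed

text \<open>
  The scalar is real and positive because it coincides with the least
  eigenvalue of the positive definite matrix \<open>A\<close>.
\<close>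

lemma pos_def_scalar_mat:
  assumes "A = \<kappa> \<cdot>\<^sub>m 1\<^sub>m n" and "hermitian_pos_def A" and n: "n > 0"
  obtains k where "k > 0" "\<kappa> = complex_of_real k"
proof -
  have A: "A \<in> carrier_mat n n" using assms(1) by simp
  have "mat_adjoint A = A" using assms(2) hermitian_pos_def_iff[OF A] by blast
  then have "eigenvalue A (complex_of_real (lambda_min A))" by (intro lambda_min_eigenvalue[OF A _ n])
  then obtain v where v: "v \<in> carrier_vec n" "v \<noteq> 0\<^sub>v n" "\<kappa> \<cdot>\<^sub>v v = complex_of_real (lambda_min A) \<cdot>\<^sub>v v"
    using A smult_one_mat_mult_vec[of _ n \<kappa>] by (auto simp: eigenvalue_def eigenvector_def assms(1))
  then obtain i where "i < n" "v $ i \<noteq> 0"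
    by (metis carrier_vecD eq_vecI index_zero_vec)
  then have "\<kappa> = complex_of_real (lambda_min A)"
    using arg_cong[OF v(3), of "\<lambda>u. u $ i"] v(1) by simp
  then show ?thesis using that hermitian_pos_def_lambda_min_pos[OF A assms(2) n] by blast
qed

section \<open>Submatrices and the Schur complement\<close>

lemma pick_eq_iff_card:
  assumes "i < card S" "j < card S"
  shows "pick S i = pick S j \<longleftrightarrow> i = j"
  using pick_mono_le[of i S j] pick_mono_le[of j S i] assms
  by (metis less_irrefl linorder_neqE_nat)

text \<open>
  The inclusion of the coordinate space of \<open>I\<close> into the full space.  It turns the extraction of a
  block into a product of matrices, so that statements about blocks become matrix algebra.
\<close>

definition coord_embed :: "nat \<Rightarrow> nat set \<Rightarrow> complex mat" where
  "coord_embed n I = mat n (card I) (\<lambda>(i, j). if i = pick I j then 1 else 0)"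

lemma coord_embed_carrier [simp]: "coord_embed n I \<in> carrier_mat n (card I)"
  by (simp add: coord_embed_def)

lemma card_index_restrict: "I \<subseteq> {..<n} \<Longrightarrow> card {i. i < n \<and> i \<in> I} = card I"
  by (rule arg_cong[of _ _ card]) auto

lemma pick_less: "I \<subseteq> {..<n} \<Longrightarrow> i < card I \<Longrightarrow> pick I i < n"
  using pick_in_set_le[of i I] by auto

lemma submatrix_eq_embed:
  assumes A: "A \<in> carrier_mat n n" and I: "I \<subseteq> {..<n}" and J: "J \<subseteq> {..<n}"
  shows "submatrix A I J = mat_adjoint (coord_embed n I) * A * coord_embed n J"
proof (rule eq_matI)
  fix i j
  assume "i < dim_row (mat_adjoint (coord_embed n I) * A * coord_embed n J)"
    and "j < dim_col (mat_adjoint (coord_embed n I) * A * coord_embed n J)"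
  then have i: "i < card I" and j: "j < card J" by (auto simp: coord_embed_def)
  have pi: "pick I i < n" and pj: "pick J j < n" using pick_less I J i j by auto
  have left: "(mat_adjoint (coord_embed n I) * A) $$ (i, l) = A $$ (pick I i, l)" if l: "l < n" for l
  proof -
    have "(mat_adjoint (coord_embed n I) * A) $$ (i, l) =
        (\<Sum>k<n. (if k = pick I i then 1 else 0) * A $$ (k, l))"
      using A i l by (auto simp: scalar_prod_def lessThan_atLeast0 coord_embed_def intro!: sum.cong)
    then show ?thesis using pi by (simp add: if_distrib[of "\<lambda>x. x * _"] cong: if_cong)
  qed
  have "(mat_adjoint (coord_embed n I) * A * coord_embed n J) $$ (i, j) =
      (\<Sum>l<n. (mat_adjoint (coord_embed n I) * A) $$ (i, l) * (if l = pick J j then 1 else 0))"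
    using A i j by (auto simp: scalar_prod_def lessThan_atLeast0 coord_embed_def intro!: sum.cong)
  also have "\<dots> = A $$ (pick I i, pick J j)"
    using pj left by (simp add: if_distrib[of "\<lambda>x. _ * x"] cong: if_cong)
  also have "\<dots> = submatrix A I J $$ (i, j)"
    using A I J i j by (simp add: submatrix_index card_index_restrict)
  finally show "submatrix A I J $$ (i, j) = (mat_adjoint (coord_embed n I) * A * coord_embed n J) $$ (i, j)" ..
qed (use A I J in \<open>auto simp: dim_submatrix card_index_restrict coord_embed_def\<close>)

lemma coord_embed_inner:
  assumes I: "I \<subseteq> {..<n}" and J: "J \<subseteq> {..<n}"
  shows "mat_adjoint (coord_embed n I) * coord_embed n J =
    mat (card I) (card J) (\<lambda>(i, j). if pick I i = pick J j then 1 else 0)"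
proof -
  have "mat_adjoint (coord_embed n I) * coord_embed n J = submatrix (1\<^sub>m n) I J"
    using submatrix_eq_embed[OF one_carrier_mat I J] right_mult_one_mat[of "mat_adjoint (coord_embed n I)" "card I" n]
    by simp
  also have "\<dots> = mat (card I) (card J) (\<lambda>(i, j). if pick I i = pick J j then 1 else 0)"
    using I J by (intro eq_matI) (auto simp: dim_submatrix submatrix_index card_index_restrict pick_less)
  finally show ?thesis .
qed

lemma coord_embed_isometry:
  assumes "I \<subseteq> {..<n}"
  shows "mat_adjoint (coord_embed n I) * coord_embed n I = 1\<^sub>m (card I)"
  unfolding coord_embed_inner[OF assms assms]
  by (intro eq_matI) (auto simp: pick_eq_iff_card)

lemma coord_embed_disjoint:
  assumes "I \<subseteq> {..<n}" "J \<subseteq> {..<n}" "I \<inter> J = {}"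
  shows "mat_adjoint (coord_embed n I) * coord_embed n J = 0\<^sub>m (card I) (card J)"
proof -
  have "pick I i \<noteq> pick J j" if "i < card I" "j < card J" for i j
    using pick_in_set_le[OF that(1)] pick_in_set_le[OF that(2)] assms(3) by auto
  then show ?thesis
    unfolding coord_embed_inner[OF assms(1,2)] by (intro eq_matI) auto
qed

lemma mat_inverse_of_det_nonzero:
  fixes A :: "'a :: field mat"
  assumes A: "A \<in> carrier_mat n n" and det: "det A \<noteq> 0"
  shows "the (mat_inverse A) \<in> carrier_mat n n" "A * the (mat_inverse A) = 1\<^sub>m n"
proof -
  obtain B where "mat_inverse A = Some B"
    using mat_inverse(1)[OF A, of "()"] det_non_zero_imp_unit[OF A det, of "()"] by (cases "mat_inverse A") auto
  then show "the (mat_inverse A) \<in> carrier_mat n n" "A * the (mat_inverse A) = 1\<^sub>m n"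
    using mat_inverse(2)[OF A] by auto
qed

text \<open>
  Block elimination.  With \<open>P\<close> and \<open>Q\<close> the embeddings of \<open>C\<close> and \<open>D\<close>, the matrix
  \<open>T = Q - P X\<close>, where \<open>X\<close> is the inverse of the block on \<open>C\<close> times the block with rows in \<open>C\<close>
  and columns in \<open>D\<close>, is chosen so that the rows of \<open>K T\<close> in \<open>C\<close> vanish.  Then only its rows in \<open>D\<close>
  contribute to \<open>T\<^sup>H K T\<close>, and these form the Schur complement.  The embeddings have orthogonal ranges, hence the adjoint of \<open>Q\<close> is a left inverse of \<open>T\<close>.
\<close>

lemma schur_complement_congruence:
  assumes K: "K \<in> carrier_mat n n" and C: "C \<subseteq> {..<n}" and D: "D \<subseteq> {..<n}" and CD: "C \<inter> D = {}"
    and det: "det (submatrix K C C) \<noteq> 0"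
  obtains T where "T \<in> carrier_mat n (card D)"
    "mat_adjoint (coord_embed n D) * T = 1\<^sub>m (card D)"
    "schur_complement K C D = mat_adjoint T * K * T"
proof -
  define c d P Q where defs: "c = card C" "d = card D" "P = coord_embed n C" "Q = coord_embed n D"
  have P [simp]: "P \<in> carrier_mat n c" and Q [simp]: "Q \<in> carrier_mat n d" by (simp_all add: defs)
  have P' [simp]: "mat_adjoint P \<in> carrier_mat c n" and Q' [simp]: "mat_adjoint Q \<in> carrier_mat d n"
    by simp_all
  have blocks: "submatrix K C C = mat_adjoint P * K * P" "submatrix K C D = mat_adjoint P * K * Q"
    "submatrix K D C = mat_adjoint Q * K * P" "submatrix K D D = mat_adjoint Q * K * Q"
    using submatrix_eq_embed[OF K] C D by (simp_all add: defs)
  have PK: "mat_adjoint P * K \<in> carrier_mat c n" and QK: "mat_adjoint Q * K \<in> carrier_mat d n"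
    using mult_carrier_mat[OF P' K] mult_carrier_mat[OF Q' K] by simp_all
  have CC: "submatrix K C C \<in> carrier_mat c c" and CDc: "submatrix K C D \<in> carrier_mat c d"
    and DCc: "submatrix K D C \<in> carrier_mat d c" and DDc: "submatrix K D D \<in> carrier_mat d d"
    unfolding blocks
    using mult_carrier_mat[OF PK P] mult_carrier_mat[OF PK Q]
      mult_carrier_mat[OF QK P] mult_carrier_mat[OF QK Q] by simp_all
  define G where "G = the (mat_inverse (submatrix K C C))"
  have G: "G \<in> carrier_mat c c" and inv: "submatrix K C C * G = 1\<^sub>m c"
    using mat_inverse_of_det_nonzero[OF CC det] by (simp_all add: G_def)
  define X where "X = G * submatrix K C D"
  have X: "X \<in> carrier_mat c d" unfolding X_def using G CDc by (rule mult_carrier_mat)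
  define T where "T = Q - P * X"
  have PX: "P * X \<in> carrier_mat n d" using P X by (rule mult_carrier_mat)
  have T: "T \<in> carrier_mat n d" unfolding T_def using PX by (rule minus_carrier_mat)
  have CX: "submatrix K C C * X = submatrix K C D"
    using assoc_mult_mat[OF CC G CDc] inv CDc by (simp add: X_def)
  have PKT: "mat_adjoint P * K * T = 0\<^sub>m c d"
    using mult_minus_distrib_mat[OF PK Q PX] assoc_mult_mat[OF PK P X] CX CDc
    by (simp add: T_def flip: blocks)
  have QKT: "mat_adjoint Q * K * T = schur_complement K C D"
    using mult_minus_distrib_mat[OF QK Q PX] assoc_mult_mat[OF QK P X] assoc_mult_mat[OF DCc G CDc]
    by (simp add: T_def schur_complement_def X_def G_def flip: blocks)
  have X': "mat_adjoint X \<in> carrier_mat d c" using X by simp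
  have XP: "mat_adjoint X * mat_adjoint P \<in> carrier_mat d n" using X' P' by (rule mult_carrier_mat)
  have adjT: "mat_adjoint T = mat_adjoint Q - mat_adjoint X * mat_adjoint P"
  proof -
    have "mat_adjoint T = mat_adjoint Q - mat_adjoint (P * X)"
      unfolding T_def using carrier_matD[OF Q] carrier_matD[OF PX]
      by (intro eq_matI) auto
    then show ?thesis using adjoint_times[OF P X] by simp
  qed
  have KT: "K * T \<in> carrier_mat n d" using K T by (rule mult_carrier_mat)
  have "mat_adjoint T * K * T = mat_adjoint T * (K * T)"
    using assoc_mult_mat[OF adjoint_carrier[OF T] K T] .
  also have "\<dots> = mat_adjoint Q * (K * T) - mat_adjoint X * mat_adjoint P * (K * T)"
    unfolding adjT using minus_mult_distrib_mat[OF Q' XP KT] .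
  also have "mat_adjoint X * mat_adjoint P * (K * T) = mat_adjoint X * (mat_adjoint P * K * T)"
    using assoc_mult_mat[OF X' P' KT] assoc_mult_mat[OF P' K T] by simp
  also have "\<dots> = 0\<^sub>m d d" unfolding PKT using right_mult_zero_mat[OF X'] .
  also have "mat_adjoint Q * (K * T) = schur_complement K C D"
    using assoc_mult_mat[OF Q' K T] QKT by simp
  finally have eq: "mat_adjoint T * K * T = schur_complement K C D"
    using minus_zero_mat[OF mult_carrier_mat[OF QK T]] by (simp only: QKT)
  have "mat_adjoint Q * T = 1\<^sub>m d - mat_adjoint Q * P * X"
    unfolding T_def using mult_minus_distrib_mat[OF Q' Q PX] assoc_mult_mat[OF Q' P X]
      coord_embed_isometry[OF D] by (simp add: defs)
  also have "mat_adjoint Q * P = 0\<^sub>m d c"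
    using coord_embed_disjoint[OF D C] CD by (simp add: defs Int_commute)
  finally have "mat_adjoint Q * T = 1\<^sub>m d" using X by (simp add: minus_zero_mat)
  then show ?thesis using that[of T] T eq by (simp add: defs)
qed

text \<open>
  Both the block on \<open>C\<close> and the Schur complement are congruent images of \<open>K\<close> under matrices that have a left
  inverse; the former is needed first, to invert the block.
\<close>

lemma schur_complement_pos_def:
  assumes K: "K \<in> carrier_mat n n" and pd: "hermitian_pos_def K"
    and C: "C \<subseteq> {..<n}" and D: "D \<subseteq> {..<n}" and CD: "C \<inter> D = {}"
  shows "schur_complement K C D \<in> carrier_mat (card D) (card D)"
    and "hermitian_pos_def (schur_complement K C D)"
proof -
  have "hermitian_pos_def (submatrix K C C)"
    unfolding submatrix_eq_embed[OF K C C]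
    using hermitian_pos_def_congruence[OF K pd _ _ coord_embed_isometry[OF C]] by simp
  moreover have "submatrix K C C \<in> carrier_mat (card C) (card C)"
    using K C by (auto simp: dim_submatrix card_index_restrict intro!: carrier_matI)
  ultimately have "det (submatrix K C C) \<noteq> 0" by (intro hermitian_pos_def_det_nonzero)
  then obtain T where T: "T \<in> carrier_mat n (card D)"
    "mat_adjoint (coord_embed n D) * T = 1\<^sub>m (card D)"
    "schur_complement K C D = mat_adjoint T * K * T"
    using schur_complement_congruence[OF K C D CD] by blast
  show "schur_complement K C D \<in> carrier_mat (card D) (card D)"
    unfolding T(3) using T(1) K by (intro mult_carrier_mat[OF mult_carrier_mat[OF adjoint_carrier]]) auto
  show "hermitian_pos_def (schur_complement K C D)"
    unfolding T(3) using hermitian_pos_def_congruence[OF K pd T(1) _ T(2)] by simp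
qed

lemma submatrix_scalar_shift:
  assumes R: "R \<in> carrier_mat n n" and D: "D \<subseteq> {..<n}"
  shows "submatrix (map_mat complex_of_real R + a \<cdot>\<^sub>m 1\<^sub>m n) D D =
    map_mat complex_of_real (submatrix R D D) + a \<cdot>\<^sub>m 1\<^sub>m (card D)"
  using R D
  by (intro eq_matI) (auto simp: dim_submatrix submatrix_index card_index_restrict pick_less pick_eq_iff_card)

section \<open>The smallest singular value\<close>

text \<open>
  If \<open>A B v = k v\<close>, then \<open>B v\<close> is an eigenvector of \<open>B A\<close>, unless it is zero.  In that case \<open>k = 0\<close>
  and \<open>B\<close> is singular, so that \<open>B A\<close> is singular as well.
\<close>

lemma eigenvalue_mult_commute:
  assumes A: "A \<in> carrier_mat n n" and B: "B \<in> carrier_mat n n" and ev: "eigenvalue (A * B) k"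
  shows "eigenvalue (B * A) (k :: 'a :: field)"
proof -
  have AB: "A * B \<in> carrier_mat n n" and BA: "B * A \<in> carrier_mat n n"
    using A B by (auto intro: mult_carrier_mat)
  from ev obtain v where v: "v \<in> carrier_vec n" "v \<noteq> 0\<^sub>v n" "A * B *\<^sub>v v = k \<cdot>\<^sub>v v"
    using A by (auto simp: eigenvalue_def eigenvector_def)
  have ABv: "A *\<^sub>v (B *\<^sub>v v) = k \<cdot>\<^sub>v v" using v assoc_mult_mat_vec[OF A B v(1)] by simp
  have Bv: "B *\<^sub>v v \<in> carrier_vec n" using B v by simp
  show ?thesis
  proof (cases "B *\<^sub>v v = 0\<^sub>v n")
    case False
    have "B * A *\<^sub>v (B *\<^sub>v v) = B *\<^sub>v (k \<cdot>\<^sub>v v)"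
      using assoc_mult_mat_vec[OF B A Bv] ABv by simp
    also have "\<dots> = k \<cdot>\<^sub>v (B *\<^sub>v v)" using mult_mat_vec[OF B v(1)] .
    finally show ?thesis using False Bv B by (auto simp: eigenvalue_def eigenvector_def)
  next
    case True
    have kv: "k \<cdot>\<^sub>v v = 0\<^sub>v n" using ABv True mat_mult_zero_vec[OF A] by simp
    have k: "k = 0"
    proof (rule ccontr)
      assume "k \<noteq> 0"
      have "v = 0\<^sub>v n"
      proof (rule eq_vecI)
        fix i assume "i < dim_vec (0\<^sub>v n :: 'a vec)"
        then show "v $ i = 0\<^sub>v n $ i"
          using arg_cong[OF kv, of "\<lambda>u. u $ i"] v(1) \<open>k \<noteq> 0\<close> by simp
      qed (use v in simp)
      then show False using v(2) by simp
    qed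
    have "det B = 0" using det_0_iff_vec_prod_zero_field[OF B] v True by blast
    then have "det (B * A) = 0" using det_mult[OF B A] by simp
    moreover have "char_matrix (B * A) 0 = B * A"
      unfolding char_matrix_def using A B by (intro eq_matI) auto
    ultimately show ?thesis using eigenvalue_det[OF BA] k by simp
  qed
qed

lemma lambda_min_mult_commute:
  assumes "A \<in> carrier_mat n n" "B \<in> carrier_mat n n"
  shows "lambda_min (A * B) = lambda_min (B * A)"
  unfolding lambda_min_def using eigenvalue_mult_commute assms by metis

lemma gram_hermitian: "mat_adjoint (mat_adjoint M * M) = mat_adjoint M * (M :: complex mat)"
  using adjoint_times[OF adjoint_carrier[OF carrier_mat_triv] carrier_mat_triv, of M]
  by (simp only: adjoint_adjoint)

lemma quad_form_gram:
  assumes "M \<in> carrier_mat k n" "v \<in> carrier_vec n"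
  shows "quad_form (mat_adjoint M * M) v = Re ((M *\<^sub>v v) \<bullet>c (M *\<^sub>v v))"
  using quad_form_congruence[OF one_carrier_mat assms] assms
    right_mult_one_mat[OF adjoint_carrier[OF assms(1)]] by simp

text \<open>
  The Gram matrix is positive semidefinite, so that its least eigenvalue has a square root, and this is
  the least singular value because the square root is monotone.
\<close>

lemma sigma_min_square:
  assumes M: "M \<in> carrier_mat n n" and n: "n > 0"
  shows "(sigma_min M)\<^sup>2 = lambda_min (mat_adjoint M * M)"
proof -
  let ?G = "mat_adjoint M * M"
  let ?t = "lambda_min ?G"
  have G: "?G \<in> carrier_mat n n" using M by (intro mult_carrier_mat[OF adjoint_carrier])
  have ev: "eigenvalue ?G (complex_of_real ?t)"
    by (rule lambda_min_eigenvalue[OF G gram_hermitian n])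
  have t0: "?t \<ge> 0"
    by (rule lambda_min_geI[OF G gram_hermitian n])
      (simp add: quad_form_gram[OF M] cscalar_prod_self_nonneg)
  have "sigma_min M = sqrt ?t"
    unfolding sigma_min_def
  proof (rule Min_eqI)
    have "singular_values M \<subseteq> sqrt ` {x. eigenvalue ?G (complex_of_real x)}"
      by (force simp: singular_values_def image_iff intro: exI[of _ "_\<^sup>2"])
    then show "finite (singular_values M)"
      using finite_real_eigenvalues[OF G] finite_surj by blast
    show "sqrt ?t \<in> singular_values M"
      using ev t0 by (simp add: singular_values_def del: of_real_power)
    fix s assume "s \<in> singular_values M"
    then have "s \<ge> 0" "?t \<le> s\<^sup>2" using lambda_min_le[OF G] by (auto simp: singular_values_def)
    then show "sqrt ?t \<le> s" by (simp add: real_le_lsqrt)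
  qed
  then show ?thesis using t0 by simp
qed

text \<open>
  The mixed term of \<open>|M v + i \<omega> v|\<^sup>2\<close> is \<open>2 \<omega>\<close> times the imaginary part of \<open>\<langle>M v, v\<rangle>\<close>, which is the
  quadratic form of \<open>- i M\<close>; written in this way it falls under the general bound for quadratic forms.
\<close>

lemma quad_form_gram_imaginary_shift:
  assumes M: "M \<in> carrier_mat n n" and v: "v \<in> carrier_vec n"
  shows "quad_form (mat_adjoint (M + (\<i> * complex_of_real \<omega>) \<cdot>\<^sub>m 1\<^sub>m n) * (M + (\<i> * complex_of_real \<omega>) \<cdot>\<^sub>m 1\<^sub>m n)) v =
    quad_form (mat_adjoint M * M) v + 2 * \<omega> * quad_form ((- \<i>) \<cdot>\<^sub>m M) v + \<omega>\<^sup>2 * Re (v \<bullet>c v)"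
proof -
  let ?a = "\<i> * complex_of_real \<omega>"
  let ?N = "M + ?a \<cdot>\<^sub>m 1\<^sub>m n"
  have N: "?N \<in> carrier_mat n n" using M by simp
  have Mv: "M *\<^sub>v v \<in> carrier_vec n" using M v by simp
  have Nv: "?N *\<^sub>v v = M *\<^sub>v v + ?a \<cdot>\<^sub>v v"
    using add_mult_distrib_mat_vec[OF M _ v, of "?a \<cdot>\<^sub>m 1\<^sub>m n"] v by (simp add: smult_one_mat_mult_vec)
  have c: "conjugate (M *\<^sub>v v + ?a \<cdot>\<^sub>v v) = conjugate (M *\<^sub>v v) + cnj ?a \<cdot>\<^sub>v conjugate v"
    using Mv v by (subst conjugate_add_vec[of _ n]) (auto simp: conjugate_smult_vec)
  have e1: "(?N *\<^sub>v v) \<bullet>c (?N *\<^sub>v v) =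
      (M *\<^sub>v v) \<bullet>c (M *\<^sub>v v) + cnj ?a * ((M *\<^sub>v v) \<bullet>c v) + ?a * (v \<bullet>c (M *\<^sub>v v)) + ?a * cnj ?a * (v \<bullet>c v)"
    unfolding Nv c using Mv v
    by (simp add: add_scalar_prod_distrib[of _ n] scalar_prod_add_distrib[of _ n] algebra_simps)
  have e2: "v \<bullet>c (M *\<^sub>v v) = cnj ((M *\<^sub>v v) \<bullet>c v)"
    using v carrier_vecD[OF Mv] by (auto simp: scalar_prod_def mult.commute intro!: sum.cong)
  have e3: "((- \<i>) \<cdot>\<^sub>m M *\<^sub>v v) \<bullet>c v = - \<i> * ((M *\<^sub>v v) \<bullet>c v)"
  proof -
    have "(- \<i>) \<cdot>\<^sub>m M *\<^sub>v v = (- \<i>) \<cdot>\<^sub>v (M *\<^sub>v v)" using M v by (intro eq_vecI) auto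
    then show ?thesis using Mv v by simp
  qed
  show ?thesis
    unfolding quad_form_gram[OF N v] quad_form_gram[OF M v] e1 e2 e3
    by (simp add: power2_eq_square)
qed

text \<open>
  At an eigenvector for the least eigenvalue of the Gram matrix, the preceding expansion shows that the
  squared singular value differs from \<open>\<omega>\<^sup>2\<close> by at most \<open>c + 2 |\<omega>| d\<close>, which is negligible against
  \<open>\<omega>\<^sup>2\<close>.
\<close>

lemma sigma_min_imaginary_shift_asymp:
  assumes M: "M \<in> carrier_mat n n" and n: "n > 0"
  shows "((\<lambda>\<omega>::real. (sigma_min (M + (\<i> * complex_of_real \<omega>) \<cdot>\<^sub>m 1\<^sub>m n))\<^sup>2 / \<omega>\<^sup>2) \<longlongrightarrow> 1) at_infinity"
proof -
  let ?N = "\<lambda>\<omega>::real. M + (\<i> * complex_of_real \<omega>) \<cdot>\<^sub>m 1\<^sub>m n"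
  have MM: "mat_adjoint M * M \<in> carrier_mat n n" using M by (intro mult_carrier_mat[OF adjoint_carrier])
  have iM: "(- \<i>) \<cdot>\<^sub>m M \<in> carrier_mat n n" using M by simp
  obtain c where c: "\<And>v. v \<in> carrier_vec n \<Longrightarrow> \<bar>quad_form (mat_adjoint M * M) v\<bar> \<le> c * Re (v \<bullet>c v)"
    using quad_form_bounded[OF MM] by blast
  obtain d where d: "\<And>v. v \<in> carrier_vec n \<Longrightarrow> \<bar>quad_form ((- \<i>) \<cdot>\<^sub>m M) v\<bar> \<le> d * Re (v \<bullet>c v)"
    using quad_form_bounded[OF iM] by blast
  have close: "\<bar>(sigma_min (?N \<omega>))\<^sup>2 - \<omega>\<^sup>2\<bar> \<le> c + 2 * \<bar>\<omega>\<bar> * d" for \<omega>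
  proof -
    have N: "?N \<omega> \<in> carrier_mat n n" using M by simp
    let ?G = "mat_adjoint (?N \<omega>) * ?N \<omega>"
    have G: "?G \<in> carrier_mat n n" using N by (intro mult_carrier_mat[OF adjoint_carrier])
    obtain v where v: "v \<in> carrier_vec n" "Re (v \<bullet>c v) > 0" "quad_form ?G v = lambda_min ?G * Re (v \<bullet>c v)"
      using eigenvalue_quad_form[OF G lambda_min_eigenvalue[OF G gram_hermitian n]] .
    let ?r = "Re (v \<bullet>c v)"
    have "((sigma_min (?N \<omega>))\<^sup>2 - \<omega>\<^sup>2) * ?r =
        quad_form (mat_adjoint M * M) v + 2 * \<omega> * quad_form ((- \<i>) \<cdot>\<^sub>m M) v"
      using v(3) quad_form_gram_imaginary_shift[OF M v(1), of \<omega>] sigma_min_square[OF N n]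
      by (simp add: algebra_simps)
    then have "\<bar>(sigma_min (?N \<omega>))\<^sup>2 - \<omega>\<^sup>2\<bar> * ?r \<le>
        \<bar>quad_form (mat_adjoint M * M) v\<bar> + 2 * \<bar>\<omega>\<bar> * \<bar>quad_form ((- \<i>) \<cdot>\<^sub>m M) v\<bar>"
      using v(2) abs_triangle_ineq[of "quad_form (mat_adjoint M * M) v" "2 * \<omega> * quad_form ((- \<i>) \<cdot>\<^sub>m M) v"]
        abs_mult[of "(sigma_min (?N \<omega>))\<^sup>2 - \<omega>\<^sup>2" ?r]
      by (simp add: abs_mult)
    also have "\<dots> \<le> c * ?r + 2 * \<bar>\<omega>\<bar> * (d * ?r)"
      using c[OF v(1)] d[OF v(1)] by (intro add_mono mult_left_mono) auto
    also have "\<dots> = (c + 2 * \<bar>\<omega>\<bar> * d) * ?r" by (simp add: algebra_simps)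
    finally show ?thesis using v(2) by simp
  qed
  have "((\<lambda>\<omega>. (sigma_min (?N \<omega>))\<^sup>2 / \<omega>\<^sup>2 - 1) \<longlongrightarrow> 0) at_infinity"
  proof (rule tendsto_0_le[where K = 1])
    have "\<bar>(sigma_min (?N \<omega>))\<^sup>2 / \<omega>\<^sup>2 - 1\<bar> \<le> c * (inverse \<omega>)\<^sup>2 + 2 * \<bar>inverse \<omega>\<bar> * d" if "\<omega> \<noteq> 0" for \<omega>
    proof -
      have shrink: "(sigma_min (?N \<omega>))\<^sup>2 / \<omega>\<^sup>2 - 1 = ((sigma_min (?N \<omega>))\<^sup>2 - \<omega>\<^sup>2) / \<omega>\<^sup>2"
        using that by (simp add: diff_divide_distrib)
      have "\<bar>(sigma_min (?N \<omega>))\<^sup>2 / \<omega>\<^sup>2 - 1\<bar> = \<bar>(sigma_min (?N \<omega>))\<^sup>2 - \<omega>\<^sup>2\<bar> / \<omega>\<^sup>2"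
        unfolding shrink by simp
      also have "\<dots> \<le> (c + 2 * \<bar>\<omega>\<bar> * d) / \<omega>\<^sup>2"
        by (intro divide_right_mono close) simp
      also have "\<dots> = c * (inverse \<omega>)\<^sup>2 + 2 * \<bar>inverse \<omega>\<bar> * d"
        using that by (simp add: field_simps power2_eq_square abs_if)
      finally show ?thesis .
    qed
    moreover have "eventually (\<lambda>\<omega>::real. \<omega> \<noteq> 0) at_infinity"
      unfolding eventually_at_infinity by (rule exI[of _ 1]) auto
    ultimately show "\<forall>\<^sub>F \<omega> in at_infinity. norm ((sigma_min (?N \<omega>))\<^sup>2 / \<omega>\<^sup>2 - 1)
        \<le> norm (c * (inverse \<omega>)\<^sup>2 + 2 * \<bar>inverse \<omega>\<bar> * d) * 1"
      by (elim eventually_mono) (simp add: order_trans[OF _ abs_ge_self])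
    show "((\<lambda>\<omega>::real. c * (inverse \<omega>)\<^sup>2 + 2 * \<bar>inverse \<omega>\<bar> * d) \<longlongrightarrow> 0) at_infinity"
    proof -
      have inv: "((\<lambda>\<omega>::real. inverse \<omega>) \<longlongrightarrow> 0) at_infinity" by (rule tendsto_inverse_0)
      have "((\<lambda>\<omega>::real. c * (inverse \<omega>)\<^sup>2 + 2 * \<bar>inverse \<omega>\<bar> * d) \<longlongrightarrow> c * 0\<^sup>2 + 2 * \<bar>0\<bar> * d) at_infinity"
        by (intro tendsto_add tendsto_mult tendsto_power tendsto_rabs tendsto_const inv)
      then show ?thesis by simp
    qed
  qed
  from tendsto_add[OF this tendsto_const[of 1]] show ?thesis by simp
qed

text \<open>
  The form of \<open>N A N\<^sup>H\<close> at \<open>v\<close> is the form of \<open>A\<close> at \<open>N\<^sup>H v\<close>.  What enters is therefore the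
  smallest singular value of \<open>N\<^sup>H\<close>, which is turned into that of \<open>N\<close> by the fact that \<open>N N\<^sup>H\<close> and
  \<open>N\<^sup>H N\<close> have the same eigenvalues.
\<close>

lemma lambda_min_congruence_ge:
  assumes N: "N \<in> carrier_mat n n" and A: "A \<in> carrier_mat n n" and H: "mat_adjoint A = A"
    and pos: "lambda_min A \<ge> 0" and n: "n > 0"
  shows "lambda_min (N * A * mat_adjoint N) \<ge> (sigma_min N)\<^sup>2 * lambda_min A"
proof -
  have N': "mat_adjoint N \<in> carrier_mat n n" using N by simp
  have car: "N * A * mat_adjoint N \<in> carrier_mat n n" using N A N' by (metis mult_carrier_mat)
  have herm: "mat_adjoint (N * A * mat_adjoint N) = N * A * mat_adjoint N"
    using hermitian_congruence[OF A H N'] by (simp add: adjoint_adjoint)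
  have NN: "mat_adjoint (mat_adjoint N) * mat_adjoint N \<in> carrier_mat n n"
    using mult_carrier_mat[OF adjoint_carrier[OF N'] N'] .
  have sig: "(sigma_min N)\<^sup>2 = lambda_min (mat_adjoint (mat_adjoint N) * mat_adjoint N)"
    using sigma_min_square[OF N n] lambda_min_mult_commute[OF N' N] by (simp add: adjoint_adjoint)
  show ?thesis
  proof (rule lambda_min_geI[OF car herm n])
    fix v :: "complex vec" assume v: "v \<in> carrier_vec n"
    let ?w = "mat_adjoint N *\<^sub>v v"
    have w: "?w \<in> carrier_vec n" using N' v by simp
    have "(sigma_min N)\<^sup>2 * Re (v \<bullet>c v) \<le> Re (?w \<bullet>c ?w)"
      using lambda_min_quad_form[OF NN gram_hermitian n v] unfolding sig quad_form_gram[OF N' v] .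
    then have "lambda_min A * ((sigma_min N)\<^sup>2 * Re (v \<bullet>c v)) \<le> lambda_min A * Re (?w \<bullet>c ?w)"
      using pos by (rule mult_left_mono)
    also have "\<dots> \<le> quad_form A ?w" using lambda_min_quad_form[OF A H n w] .
    also have "\<dots> = quad_form (N * A * mat_adjoint N) v"
      using quad_form_congruence[OF A N' v] by (simp add: adjoint_adjoint)
    finally show "(sigma_min N)\<^sup>2 * lambda_min A * Re (v \<bullet>c v) \<le> quad_form (N * A * mat_adjoint N) v"
      by (simp add: mult_ac)
  qed
qed

section \<open>Scaled and shifted squares of matrices\<close>

text \<open>
  With \<open>a = i \<omega>\<close> and Hermitian \<open>M\<close> this is the product of \<open>M + i \<omega> I\<close> and its adjoint; with a square
  root \<open>a\<close> of \<open>x\<close> it factors the characteristic matrix of \<open>M\<^sup>2\<close> at \<open>x\<close>.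
\<close>

lemma shift_mult_opposite_shift:
  fixes M :: "'a :: comm_ring_1 mat"
  assumes M: "M \<in> carrier_mat n n"
  shows "(M + a \<cdot>\<^sub>m 1\<^sub>m n) * (M + (- a) \<cdot>\<^sub>m 1\<^sub>m n) = M * M + (- (a\<^sup>2)) \<cdot>\<^sub>m 1\<^sub>m n"
proof -
  have I: "b \<cdot>\<^sub>m 1\<^sub>m n \<in> carrier_mat n n" for b :: 'a by simp
  have Mb: "M + b \<cdot>\<^sub>m 1\<^sub>m n \<in> carrier_mat n n" for b using M by simp
  have l: "b \<cdot>\<^sub>m 1\<^sub>m n * A = b \<cdot>\<^sub>m A" if "A \<in> carrier_mat n n" for b and A :: "'a mat"
    using mult_smult_assoc_mat[OF one_carrier_mat that, of b] left_mult_one_mat[OF that] by simp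
  have r: "A * (b \<cdot>\<^sub>m 1\<^sub>m n) = b \<cdot>\<^sub>m A" if "A \<in> carrier_mat n n" for b and A :: "'a mat"
    using mult_smult_distrib[OF that one_carrier_mat, of b] right_mult_one_mat[OF that] by simp
  have "(M + a \<cdot>\<^sub>m 1\<^sub>m n) * (M + (- a) \<cdot>\<^sub>m 1\<^sub>m n) =
      (M * M + (- a) \<cdot>\<^sub>m M) + a \<cdot>\<^sub>m (M + (- a) \<cdot>\<^sub>m 1\<^sub>m n)"
    using add_mult_distrib_mat[OF M I Mb, of a "- a"] mult_add_distrib_mat[OF M M I, of "- a"]
      l[OF Mb, of a "- a"] r[OF M, of "- a"] by simp
  also have "\<dots> = M * M + (- (a\<^sup>2)) \<cdot>\<^sub>m 1\<^sub>m n"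
    using M by (intro eq_matI) (auto simp: power2_eq_square algebra_simps)
  finally show ?thesis .
qed

lemma eigenvalue_square:
  fixes M :: "complex mat"
  assumes M: "M \<in> carrier_mat n n" and ev: "eigenvalue (M * M) x"
  obtains y where "eigenvalue M y" "y\<^sup>2 = x"
proof -
  let ?y = "csqrt x"
  have MM: "M * M \<in> carrier_mat n n" using M M by (rule mult_carrier_mat)
  have cM: "char_matrix M z \<in> carrier_mat n n" for z using M by simp
  have "char_matrix M ?y * char_matrix M (- ?y) = char_matrix (M * M) x"
    using shift_mult_opposite_shift[OF M, of "- ?y"] M by (simp add: char_matrix_def)
  then have "det (char_matrix M ?y) * det (char_matrix M (- ?y)) = 0"
    using det_mult[OF cM cM] ev eigenvalue_det[OF MM] by metis
  then have "eigenvalue M ?y \<or> eigenvalue M (- ?y)" using eigenvalue_det[OF M] by auto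
  then show ?thesis using that[of ?y] that[of "- ?y"] by auto
qed

lemma mult_vec_scaled_square_shift:
  fixes M :: "complex mat"
  assumes M: "M \<in> carrier_mat n n" and v: "v \<in> carrier_vec n"
  shows "k \<cdot>\<^sub>m (M * M + c \<cdot>\<^sub>m 1\<^sub>m n) *\<^sub>v v = k \<cdot>\<^sub>v (M *\<^sub>v (M *\<^sub>v v) + c \<cdot>\<^sub>v v)"
proof -
  have MM: "M * M \<in> carrier_mat n n" using M M by (rule mult_carrier_mat)
  have "k \<cdot>\<^sub>m (M * M + c \<cdot>\<^sub>m 1\<^sub>m n) *\<^sub>v v = k \<cdot>\<^sub>v ((M * M + c \<cdot>\<^sub>m 1\<^sub>m n) *\<^sub>v v)"
    using M v by (intro eq_vecI) auto
  then show ?thesis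
    using add_mult_distrib_mat_vec[OF MM _ v, of "c \<cdot>\<^sub>m 1\<^sub>m n"] assoc_mult_mat_vec[OF M M v]
      smult_one_mat_mult_vec[OF v] by simp
qed

text \<open>
  An eigenvector of \<open>M\<^sup>2\<close> need not be one of \<open>M\<close>; the implication from left to right therefore passes through
  the eigenvalues of \<open>M\<^sup>2\<close>, which are squares of eigenvalues of \<open>M\<close>.
\<close>

lemma eigenvalue_scaled_square_shift_iff:
  fixes M :: "complex mat"
  assumes M: "M \<in> carrier_mat n n" and k: "k \<noteq> 0"
  shows "eigenvalue (k \<cdot>\<^sub>m (M * M + c \<cdot>\<^sub>m 1\<^sub>m n)) x \<longleftrightarrow> (\<exists>y. eigenvalue M y \<and> x = k * (y\<^sup>2 + c))"
proof
  have MM: "M * M \<in> carrier_mat n n" using M M by (rule mult_carrier_mat)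
  assume "eigenvalue (k \<cdot>\<^sub>m (M * M + c \<cdot>\<^sub>m 1\<^sub>m n)) x"
  then obtain v where v: "v \<in> carrier_vec n" "v \<noteq> 0\<^sub>v n"
    "k \<cdot>\<^sub>v (M *\<^sub>v (M *\<^sub>v v) + c \<cdot>\<^sub>v v) = x \<cdot>\<^sub>v v"
    using M mult_vec_scaled_square_shift[OF M] by (auto simp: eigenvalue_def eigenvector_def)
  have "M * M *\<^sub>v v = (x / k - c) \<cdot>\<^sub>v v"
  proof (rule eq_vecI)
    fix i assume "i < dim_vec ((x / k - c) \<cdot>\<^sub>v v)"
    then have i: "i < n" using v by simp
    have "k * ((M *\<^sub>v (M *\<^sub>v v)) $ i + c * v $ i) = x * v $ i"
      using arg_cong[OF v(3), of "\<lambda>u. u $ i"] i v(1) M by (simp del: index_mult_mat_vec)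
    then show "(M * M *\<^sub>v v) $ i = ((x / k - c) \<cdot>\<^sub>v v) $ i"
      unfolding assoc_mult_mat_vec[OF M M v(1)] using i v(1) k
      by (simp add: field_simps del: index_mult_mat_vec)
  qed (use M v in auto)
  then have "eigenvalue (M * M) (x / k - c)"
    using v M by (auto simp: eigenvalue_def eigenvector_def)
  then obtain y where "eigenvalue M y" "y\<^sup>2 = x / k - c" using eigenvalue_square[OF M] by blast
  then show "\<exists>y. eigenvalue M y \<and> x = k * (y\<^sup>2 + c)" using k by (auto intro!: exI[of _ y])
next
  assume "\<exists>y. eigenvalue M y \<and> x = k * (y\<^sup>2 + c)"
  then obtain y v where v: "v \<in> carrier_vec n" "v \<noteq> 0\<^sub>v n" "M *\<^sub>v v = y \<cdot>\<^sub>v v" "x = k * (y\<^sup>2 + c)"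
    using M by (auto simp: eigenvalue_def eigenvector_def)
  have "k \<cdot>\<^sub>m (M * M + c \<cdot>\<^sub>m 1\<^sub>m n) *\<^sub>v v = x \<cdot>\<^sub>v v"
    unfolding mult_vec_scaled_square_shift[OF M v(1)] v(3) mult_mat_vec[OF M v(1)] v(4)
    using v(1) by (intro eq_vecI) (auto simp: power2_eq_square algebra_simps)
  then show "eigenvalue (k \<cdot>\<^sub>m (M * M + c \<cdot>\<^sub>m 1\<^sub>m n)) x"
    using v M by (auto simp: eigenvalue_def eigenvector_def)
qed

lemma smallest_modulus_eigenvalue_exists:
  assumes M: "M \<in> carrier_mat n n" and n: "n > 0"
  shows "\<exists>\<mu>. smallest_modulus_eigenvalue M \<mu>"
proof -
  have fin: "finite (cmod ` spectrum M)" using card_finite_spectrum(1)[OF M] by simp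
  moreover have "cmod ` spectrum M \<noteq> {}" using spectrum_non_empty[OF M n] by simp
  ultimately have "Min (cmod ` spectrum M) \<in> cmod ` spectrum M" by (rule Min_in)
  then obtain \<mu> where "\<mu> \<in> spectrum M" "Min (cmod ` spectrum M) = cmod \<mu>" by auto
  then show ?thesis
    using Min_le[OF fin] by (auto simp: smallest_modulus_eigenvalue_def spectrum_def)
qed

text \<open>
  The eigenvalues of \<open>M\<close> are real, so that ordering their squares is the same as ordering their moduli.
\<close>

lemma lambda_min_scaled_square_shift:
  assumes M: "M \<in> carrier_mat n n" and H: "mat_adjoint M = M" and k: "k > 0"
    and \<mu>: "smallest_modulus_eigenvalue M \<mu>"
  shows "complex_of_real (lambda_min (complex_of_real k \<cdot>\<^sub>m (M * M + complex_of_real c \<cdot>\<^sub>m 1\<^sub>m n)))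
    = complex_of_real k * (\<mu>\<^sup>2 + complex_of_real c)"
proof -
  let ?A = "complex_of_real k \<cdot>\<^sub>m (M * M + complex_of_real c \<cdot>\<^sub>m 1\<^sub>m n)"
  have A: "?A \<in> carrier_mat n n" using M by simp
  have k0: "complex_of_real k \<noteq> 0" using k by simp
  note ev_iff = eigenvalue_scaled_square_shift_iff[OF M k0]
  have real: "z = complex_of_real (Re z)" if "eigenvalue M z" for z
    using hermitian_eigenvalue_real[OF M H that] .
  have ev: "eigenvalue M \<mu>" and least: "\<And>\<nu>. eigenvalue M \<nu> \<Longrightarrow> cmod \<mu> \<le> cmod \<nu>"
    using \<mu> by (auto simp: smallest_modulus_eigenvalue_def)
  define m where "m = Re \<mu>"
  have m: "\<mu> = complex_of_real m" using real[OF ev] by (simp add: m_def)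
  have "lambda_min ?A = k * (m\<^sup>2 + c)"
  proof (rule lambda_min_eqI[OF A])
    show "eigenvalue ?A (complex_of_real (k * (m\<^sup>2 + c)))"
      unfolding ev_iff using ev m by (intro exI[of _ \<mu>]) simp
    fix x assume "eigenvalue ?A (complex_of_real x)"
    then obtain y where y: "eigenvalue M y" "complex_of_real x = complex_of_real k * (y\<^sup>2 + complex_of_real c)"
      unfolding ev_iff by blast
    define r where "r = Re y"
    have r: "y = complex_of_real r" using real[OF y(1)] by (simp add: r_def)
    have "complex_of_real x = complex_of_real (k * (r\<^sup>2 + c))" using y(2) r by simp
    then have x: "x = k * (r\<^sup>2 + c)" by (simp only: of_real_eq_iff)
    have "\<bar>m\<bar> \<le> \<bar>r\<bar>" using least[OF y(1)] m r by simp
    then have "m\<^sup>2 \<le> r\<^sup>2" by (simp add: abs_le_square_iff)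
    then show "k * (m\<^sup>2 + c) \<le> x" unfolding x using k by simp
  qed
  then show ?thesis using m by simp
qed

section \<open>The limit matrix\<close>

lemma adjoint_symmetric_real_shift:
  assumes R: "R \<in> carrier_mat n n" and sym: "transpose_mat R = R"
  shows "mat_adjoint (map_mat complex_of_real R + a \<cdot>\<^sub>m 1\<^sub>m n) = map_mat complex_of_real R + cnj a \<cdot>\<^sub>m 1\<^sub>m n"
proof (rule eq_matI)
  fix i j assume "i < dim_row (map_mat complex_of_real R + cnj a \<cdot>\<^sub>m 1\<^sub>m n)"
    "j < dim_col (map_mat complex_of_real R + cnj a \<cdot>\<^sub>m 1\<^sub>m n)"
  then have ij: "i < n" "j < n" by auto
  have "R $$ (j, i) = R $$ (i, j)" using R ij arg_cong[OF sym, of "\<lambda>A. A $$ (i, j)"] by simp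
  then show "mat_adjoint (map_mat complex_of_real R + a \<cdot>\<^sub>m 1\<^sub>m n) $$ (i, j) =
      (map_mat complex_of_real R + cnj a \<cdot>\<^sub>m 1\<^sub>m n) $$ (i, j)"
    using R ij by simp
qed (use R in auto)

theorem corollary5p4:
  fixes n m :: nat and C D :: "nat set" and \<epsilon> :: "nat \<Rightarrow> real" and \<Gamma> :: "real mat"
    and \<xi> :: real and K :: "complex mat"
  assumes "n \<ge> 2"
    and "C \<union> D = {..<n}" and "C \<inter> D = {}"
    and "card C = m" and "m \<ge> 1" and "card D = n - m" and "n - m \<ge> 1"
    and "\<forall>i<n. \<epsilon> i > 0"
    and "\<Gamma> \<in> carrier_mat n n"
    and "\<xi> \<noteq> 0"
    and "K \<in> carrier_mat n n" and "hermitian_pos_def K"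
  defines "S0DD \<equiv> submatrix (S0_mat n \<epsilon> \<Gamma> \<xi>) D D"
  defines "S0DDc \<equiv> map_mat complex_of_real S0DD"
  defines "Ksc \<equiv> schur_complement K C D"
  defines "L \<equiv> L_inf n \<epsilon> \<Gamma> \<xi> K C D"
  defines "lower \<equiv> (\<lambda>\<omega>::real.
      (sigma_min (S0DDc + (\<i> * complex_of_real \<omega>) \<cdot>\<^sub>m 1\<^sub>m (n - m)))\<^sup>2 * lambda_min Ksc)"
  shows
    "(\<forall>\<kappa>::complex. transpose_mat S0DD = S0DD \<longrightarrow> Ksc = \<kappa> \<cdot>\<^sub>m 1\<^sub>m (n - m) \<longrightarrow>
        (\<exists>\<mu>. smallest_modulus_eigenvalue S0DDc \<mu>) \<and>
        (\<forall>\<omega>::real.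
           L \<omega> = \<kappa> \<cdot>\<^sub>m (S0DDc ^\<^sub>m 2 + (complex_of_real \<omega>)\<^sup>2 \<cdot>\<^sub>m 1\<^sub>m (n - m)) \<and>
           (\<forall>\<mu>. smallest_modulus_eigenvalue S0DDc \<mu> \<longrightarrow>
              complex_of_real (lambda_min (L \<omega>)) = \<kappa> * (\<mu>\<^sup>2 + (complex_of_real \<omega>)\<^sup>2))))
     \<and>
     ((\<forall>\<omega>::real. lambda_min (L \<omega>) \<ge> lower \<omega>) \<and>
      ((\<lambda>\<omega>::real. lower \<omega> / (\<omega>\<^sup>2 * lambda_min Ksc)) \<longlongrightarrow> 1) at_infinity)"
proof -
  let ?d = "n - m"
  let ?a = "\<lambda>\<omega>::real. \<i> * complex_of_real \<omega>"
  let ?N = "\<lambda>\<omega>. S0DDc + ?a \<omega> \<cdot>\<^sub>m 1\<^sub>m ?d"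
  have d: "?d > 0" using \<open>n - m \<ge> 1\<close> by simp
  have C: "C \<subseteq> {..<n}" and D: "D \<subseteq> {..<n}" using \<open>C \<union> D = {..<n}\<close> by auto
  have S0: "S0_mat n \<epsilon> \<Gamma> \<xi> \<in> carrier_mat n n"
    using \<open>\<Gamma> \<in> carrier_mat n n\<close> by (simp add: S0_mat_def)
  have R: "S0DD \<in> carrier_mat ?d ?d"
    using S0 D \<open>card D = n - m\<close>
    by (auto simp: S0DD_def dim_submatrix card_index_restrict intro!: carrier_matI)
  have M: "S0DDc \<in> carrier_mat ?d ?d" using R by (simp add: S0DDc_def)
  have N: "?N \<omega> \<in> carrier_mat ?d ?d" for \<omega> using M by simp
  have Ksc: "Ksc \<in> carrier_mat ?d ?d" and pd: "hermitian_pos_def Ksc"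
    using schur_complement_pos_def[OF \<open>K \<in> carrier_mat n n\<close> \<open>hermitian_pos_def K\<close> C D \<open>C \<inter> D = {}\<close>]
    by (simp_all add: Ksc_def \<open>card D = n - m\<close>)
  have H: "mat_adjoint Ksc = Ksc" using pd hermitian_pos_def_iff[OF Ksc] by blast
  have pos: "lambda_min Ksc > 0" by (rule hermitian_pos_def_lambda_min_pos[OF Ksc pd d])
  have L: "L \<omega> = ?N \<omega> * Ksc * mat_adjoint (?N \<omega>)" for \<omega>
    using submatrix_scalar_shift[OF S0 D]
    by (simp add: L_def L_inf_def S_mat_def S0DDc_def S0DD_def Ksc_def \<open>card D = n - m\<close>)
  have i: "(\<exists>\<mu>. smallest_modulus_eigenvalue S0DDc \<mu>) \<and>
        (\<forall>\<omega>::real.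
           L \<omega> = \<kappa> \<cdot>\<^sub>m (S0DDc ^\<^sub>m 2 + (complex_of_real \<omega>)\<^sup>2 \<cdot>\<^sub>m 1\<^sub>m ?d) \<and>
           (\<forall>\<mu>. smallest_modulus_eigenvalue S0DDc \<mu> \<longrightarrow>
              complex_of_real (lambda_min (L \<omega>)) = \<kappa> * (\<mu>\<^sup>2 + (complex_of_real \<omega>)\<^sup>2)))"
    if sym: "transpose_mat S0DD = S0DD" and scalar: "Ksc = \<kappa> \<cdot>\<^sub>m 1\<^sub>m ?d" for \<kappa>
  proof -
    obtain k where k: "k > 0" "\<kappa> = complex_of_real k" using pos_def_scalar_mat[OF scalar pd d] .
    have herm: "mat_adjoint S0DDc = S0DDc"
    proof -
      have "S0DDc + 0 \<cdot>\<^sub>m 1\<^sub>m ?d = S0DDc" using M by (intro eq_matI) auto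
      then show ?thesis
        using adjoint_symmetric_real_shift[OF R sym, of 0] by (simp add: S0DDc_def)
    qed
    have sq: "S0DDc ^\<^sub>m 2 = S0DDc * S0DDc" using M by (simp add: numeral_2_eq_2)
    have Leq: "L \<omega> = \<kappa> \<cdot>\<^sub>m (S0DDc * S0DDc + complex_of_real (\<omega>\<^sup>2) \<cdot>\<^sub>m 1\<^sub>m ?d)" for \<omega>
    proof -
      have adj: "mat_adjoint (?N \<omega>) = S0DDc + (- ?a \<omega>) \<cdot>\<^sub>m 1\<^sub>m ?d"
        using adjoint_symmetric_real_shift[OF R sym, of "?a \<omega>"] by (simp add: S0DDc_def)
      have "L \<omega> = \<kappa> \<cdot>\<^sub>m (?N \<omega> * mat_adjoint (?N \<omega>))"
        unfolding L scalar
        using mult_smult_distrib[OF N one_carrier_mat] right_mult_one_mat[OF N]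
          mult_smult_assoc_mat[OF N adjoint_carrier[OF N]] by simp
      then show ?thesis
        unfolding adj shift_mult_opposite_shift[OF M] by (simp add: power_mult_distrib)
    qed
    show ?thesis
    proof (intro conjI allI impI)
      show "\<exists>\<mu>. smallest_modulus_eigenvalue S0DDc \<mu>"
        by (rule smallest_modulus_eigenvalue_exists[OF M d])
      fix \<omega> :: real
      show "L \<omega> = \<kappa> \<cdot>\<^sub>m (S0DDc ^\<^sub>m 2 + (complex_of_real \<omega>)\<^sup>2 \<cdot>\<^sub>m 1\<^sub>m ?d)"
        unfolding Leq sq by simp
      fix \<mu> assume "smallest_modulus_eigenvalue S0DDc \<mu>"
      from lambda_min_scaled_square_shift[OF M herm k(1) this, of "\<omega>\<^sup>2"]
      show "complex_of_real (lambda_min (L \<omega>)) = \<kappa> * (\<mu>\<^sup>2 + (complex_of_real \<omega>)\<^sup>2)"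
        unfolding Leq k(2) by simp
    qed
  qed
  have bound: "lambda_min (L \<omega>) \<ge> lower \<omega>" for \<omega>
    unfolding L lower_def using lambda_min_congruence_ge[OF N Ksc H _ d] pos by simp
  have "(\<lambda>\<omega>. lower \<omega> / (\<omega>\<^sup>2 * lambda_min Ksc)) = (\<lambda>\<omega>. (sigma_min (?N \<omega>))\<^sup>2 / \<omega>\<^sup>2)"
    using pos by (simp add: lower_def)
  then have "((\<lambda>\<omega>::real. lower \<omega> / (\<omega>\<^sup>2 * lambda_min Ksc)) \<longlongrightarrow> 1) at_infinity"
    using sigma_min_imaginary_shift_asymp[OF M d] by simp
  with i bound show ?thesis by blast
qed

end
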